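(* Let $(U,\tau)$ be a conventional fiducial model, $\tau:\Omega_U\times\Omega_\Theta\to\Omega_T$, and assume that $T=\tau(U,\Theta)$ is $\sigma$-finite for a given ($\sigma$-finite, possibly improper) prior $P_\Theta$. Assume furthermore that, for each $u\in\Omega_U$, $\tau(u,\Theta)\sim w(t,u)\,\mu(dt)$ for some $\sigma$-finite measure $\mu$ on $\Omega_T$ (not depending on $u$) and some jointly measurable $w:\Omega_T\times\Omega_U\to[0,\infty)$. Then, for $P_T$-almost every $t$: if $u$ is a sample from the probability distribution on $\Omega_U$ proportional to $w(t,u)\,P_U^\theta(du)$, and, given $u$, $\theta$ is a sample from the conditional law $(\Theta\mid\tau(u,\Theta)=t)$, then $\theta$ is a sample from the Bayesian posterior distribution of $\Theta$ given $T=t$.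
   Context: Basic space: all random elements are measurable functions defined on a common underlying $\sigma$-finite measure space $(\Omega,\mathcal{E},P)$; $P(\Omega)=1$ is not required, and $P(\Omega)=\infty$ is allowed. A random element $Z$ in a measurable space $\Omega_Z$ is a measurable function $Z:\Omega\to\Omega_Z$. Its law (distribution) is $P_Z(A)=P(Z\in A)$, and $Z$ is called $\sigma$-finite if $P_Z$ is a $\sigma$-finite measure. We write $Z\sim m$ if the law of $Z$ is $m$. The measurable spaces $\Omega_U,\Omega_\Theta,\Omega_T$ are standard Borel spaces. Conditional laws: if $X,Y$ are random elements and $Y$ is $\sigma$-finite, the conditional law $P_X^y=(X\mid Y=y)$ is the (regular) family of probability measures, determined for $P_Y$-almost every $y$, such that $P_{X,Y}(dx,dy)=P_X^y(dx)\,P_Y(dy)$. For fixed $u$, $\tau(u,\Theta)$ is the random element $\omega\mapsto\tau(u,\Theta(\omega))$, with law $A\mapsto P_\Theta(\{\theta:\tau(u,\theta)\in A\})$; $(\Theta\mid\tau(u,\Theta)=t)$ is the conditional law of $\Theta$ given this random element, in a version jointly measurable in $(u,t)$. Bayesian model: $\Theta$ is a $\sigma$-finite random element in $\Omega_\Theta$ whose law $P_\Theta$ (the prior) is specified and may have infinite total mass. The posterior of $\Theta$ given $T=t$ is the conditional law of $\Theta$ given $T=t$, which is well defined if $T$ is $\sigma$-finite. Fiducial model: a fiducial model $(U,\tau)$ consists of a random element $U$ in a space $\Omega_U$ and a measurable function $\tau:\Omega_U\times\Omega_\Theta\to\Omega_T$, where $\Omega_T$ is the sample space. It is conventional if the conditional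 law $P_U^\theta$ of $U$ given $\Theta=\theta$ (a probability measure) does not depend on $\theta$. *)

theory Defs
  imports "HOL-Probability.Probability"
begin

text \<open>The spaces are general carriers \<open>S :: 'a measure\<close> of which only \<open>space S\<close> and \<open>sets S\<close>
  matter. A separable completely metrizable space is the same as a second countable
  completely metrizable one.\<close>

definition standard_borel_space :: "'a measure \<Rightarrow> bool" where
  "standard_borel_space S \<longleftrightarrow>
     (\<exists>X. completely_metrizable_space X \<and> second_countable X \<and>
          space S = topspace X \<and> sets S = sigma_sets (topspace X) {V. openin X V})"

definition sigma_finite_element :: "'w measure \<Rightarrow> 'y measure \<Rightarrow> ('w \<Rightarrow> 'y) \<Rightarrow> bool" where
  "sigma_finite_element M S Y \<longleftrightarrow>
     Y \<in> M \<rightarrow>\<^sub>M S \<and> sigma_finite_measure (distr M S Y)"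

text \<open>\<open>K\<close> is a version of the regular conditional law of \<open>X\<close> given \<open>Y\<close>: a probability kernel
  with \<open>P\<^sub>X\<^sub>,\<^sub>Y(dx, dy) = K y (dx) P\<^sub>Y(dy)\<close>. The kernel is total, its values on a
  \<open>P\<^sub>Y\<close>-null set being arbitrary. The notion is intended for \<open>X\<close> measurable and \<open>Y\<close> sigma-finite,
  which is not part of the definition.\<close>

definition conditional_law ::
  "'w measure \<Rightarrow> 'x measure \<Rightarrow> ('w \<Rightarrow> 'x) \<Rightarrow> 'y measure \<Rightarrow> ('w \<Rightarrow> 'y) \<Rightarrow> ('y \<Rightarrow> 'x measure) \<Rightarrow> bool"
  where
  "conditional_law M SX X SY Y K \<longleftrightarrow>
     K \<in> SY \<rightarrow>\<^sub>M prob_algebra SX \<and>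
     (\<forall>C \<in> sets (SX \<Otimes>\<^sub>M SY).
        emeasure (distr M (SX \<Otimes>\<^sub>M SY) (\<lambda>\<omega>. (X \<omega>, Y \<omega>))) C =
        (\<integral>\<^sup>+ y. (\<integral>\<^sup>+ x. indicator C (x, y) \<partial>K y) \<partial>distr M SY Y))"

definition fiducial_model ::
  "'w measure \<Rightarrow> 'u measure \<Rightarrow> 'p measure \<Rightarrow> 't measure \<Rightarrow> ('w \<Rightarrow> 'u) \<Rightarrow> ('u \<times> 'p \<Rightarrow> 't) \<Rightarrow> bool"
  where
  "fiducial_model M SU S\<Theta> ST U \<tau> \<longleftrightarrow>
     U \<in> M \<rightarrow>\<^sub>M SU \<and> \<tau> \<in> SU \<Otimes>\<^sub>M S\<Theta> \<rightarrow>\<^sub>M ST"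

text \<open>\<open>PU \<theta>\<close> is the conditional law of \<open>U\<close> given \<open>\<Theta> = \<theta>\<close>. That it does not depend on \<open>\<theta>\<close> is
  required pointwise: an almost everywhere constant version can be replaced by its constant value.\<close>

definition conventional_fiducial_model ::
  "'w measure \<Rightarrow> 'u measure \<Rightarrow> 'p measure \<Rightarrow> 't measure \<Rightarrow> ('w \<Rightarrow> 'u) \<Rightarrow> ('u \<times> 'p \<Rightarrow> 't) \<Rightarrow>
   ('w \<Rightarrow> 'p) \<Rightarrow> ('p \<Rightarrow> 'u measure) \<Rightarrow> bool"
  where
  "conventional_fiducial_model M SU S\<Theta> ST U \<tau> \<Theta> PU \<longleftrightarrow>
     fiducial_model M SU S\<Theta> ST U \<tau> \<and>
     conditional_law M SU U S\<Theta> \<Theta> PU \<and>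
     (\<forall>\<theta> \<in> space S\<Theta>. \<forall>\<theta>' \<in> space S\<Theta>. PU \<theta> = PU \<theta>')"

text \<open>The law proportional to \<open>f(u) N(du)\<close>. It is a probability measure exactly when the
  normalizing integral lies strictly between \<open>0\<close> and \<open>\<infinity>\<close>.\<close>

definition proportional_law :: "'u measure \<Rightarrow> ('u \<Rightarrow> real) \<Rightarrow> 'u measure" where
  "proportional_law N f =
     density N (\<lambda>u. ennreal (f u) / (\<integral>\<^sup>+ u'. ennreal (f u') \<partial>N))"

end

(* Averaging the disintegration of (\<Theta>, \<tau>(u, \<Theta>)) over u gives
   P(\<Theta> \<in> A, T \<in> B) = \<integral>_B \<integral> w(t,u) K(u,t)(A) P_U(du) \<mu>(dt). With A the whole space this says that
   T has density W(t) = \<integral> w(t,u) P_U(du) with respect to \<mu>; sigma-finiteness of T makes W finite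
   almost everywhere, so dividing by W exhibits the two-stage sampling law as a version of the
   conditional law of \<Theta> given T. Versions agree almost everywhere on each A, hence as measures,
   because the sigma-algebra of \<Theta> has a countable generator. *)
theory Submission
  imports Defs
begin

section \<open>Countable generators of standard Borel spaces and almost everywhere uniqueness of
  measures\<close>

text \<open>Finite intersections of members of a countable base form a countable family that is
  closed under intersection, hence a generator to which the uniqueness theorem for measures
  applies.\<close>

lemma standard_borel_space_countable_generator:
  assumes "standard_borel_space S"
  obtains G where "countable G" "Int_stable G" "space S \<in> G" "G \<subseteq> Pow (space S)"
    "sets S = sigma_sets (space S) G"
proof -
  obtain X where X: "second_countable X" "space S = topspace X"
      "sets S = sigma_sets (topspace X) {V. openin X V}"
    using assms unfolding standard_borel_space_def by blast
  obtain B where B: "countable B" "\<And>V. V \<in> B \<Longrightarrow> openin X V"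
      "\<And>V x. openin X V \<Longrightarrow> x \<in> V \<Longrightarrow> \<exists>W\<in>B. x \<in> W \<and> W \<subseteq> V"
    using X(1) unfolding second_countable_def by metis
  \<comment> \<open>\<open>\<Inter>{}\<close> is the universe of the type. Cutting with
    \<open>topspace X\<close> turns it into the whole space, so that the empty \<open>F\<close> puts
    \<open>space S\<close> into \<open>G\<close>.\<close>
  define G where "G = (\<lambda>F. \<Inter>F \<inter> topspace X) ` {F. finite F \<and> F \<subseteq> B}"
  have "countable G"
    unfolding G_def using countable_Collect_finite_subset[OF B(1)] by blast
  moreover have "Int_stable G"
  proof (rule Int_stableI)
    fix a b assume "a \<in> G" "b \<in> G"
    then obtain F F' where "finite F" "F \<subseteq> B" "finite F'" "F' \<subseteq> B"
        "a = \<Inter>F \<inter> topspace X" "b = \<Inter>F' \<inter> topspace X"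
      unfolding G_def by blast
    then have "a \<inter> b = \<Inter>(F \<union> F') \<inter> topspace X" "finite (F \<union> F')" "F \<union> F' \<subseteq> B"
      by auto
    then show "a \<inter> b \<in> G"
      unfolding G_def by blast
  qed
  moreover have "space S \<in> G"
  proof -
    have "topspace X = \<Inter>{} \<inter> topspace X" by simp
    then show ?thesis unfolding G_def X(2) by blast
  qed
  moreover have "G \<subseteq> Pow (space S)"
    unfolding G_def X(2) by blast
  moreover have "sets S = sigma_sets (space S) G"
  proof -
    have G_open: "openin X V" if V: "V \<in> G" for V
    proof -
      obtain F where F: "finite F" "F \<subseteq> B" "V = \<Inter>F \<inter> topspace X"
        using V unfolding G_def by blast
      \<comment> \<open>With \<open>topspace X\<close> inserted the family is nonempty even for
        \<open>F = {}\<close>, as openness of a finite intersection requires.\<close>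
      then have "V = \<Inter>(insert (topspace X) F)" by auto
      moreover have "openin X (\<Inter>(insert (topspace X) F))"
        by (rule openin_Inter) (use F B(2) in auto)
      ultimately show ?thesis by simp
    qed
    have B_G: "V \<in> G" if "V \<in> B" for V
    proof -
      have "V = \<Inter>{V} \<inter> topspace X"
        using openin_subset[OF B(2)[OF that]] by auto
      moreover have "finite {V} \<and> {V} \<subseteq> B" using that by simp
      ultimately show ?thesis unfolding G_def by blast
    qed
    have "V \<in> sigma_sets (topspace X) G" if V: "openin X V" for V
    proof -
      \<comment> \<open>An open set is the union of the base sets inside it. The base is countable,
        so this union stays in the generated sigma-algebra.\<close>
      let ?F = "{W \<in> B. W \<subseteq> V}"
      have "V = \<Union>?F" using B(3)[OF V] by blast
      moreover have "\<Union>?F \<in> sigma_sets (topspace X) G"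
      proof (rule sigma_sets_UNION)
        show "countable ?F" by (rule countable_subset[OF _ B(1)]) blast
        show "W \<in> sigma_sets (topspace X) G" if "W \<in> ?F" for W
          using that B_G by (blast intro: sigma_sets.Basic)
      qed
      ultimately show ?thesis by simp
    qed
    then show ?thesis
      unfolding X using G_open
      by (intro equalityI sigma_sets_mono) auto
  qed
  ultimately show ?thesis by (rule that)
qed

text \<open>The null set in \<open>eq\<close> depends on \<open>A\<close>. Only the countably many
  \<open>A\<close> in a generator matter, so their null sets combine into one, outside of which the
  uniqueness theorem for measures applies. Finiteness of \<open>F' t\<close> passes to
  \<open>F t\<close> because \<open>space S\<close> is itself a generator, and so the constant
  sequence \<open>space S\<close> serves as the exhaustion.\<close>

lemma AE_eq_measure_if_standard_borel:
  assumes S: "standard_borel_space S"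
    and eq: "\<And>A. A \<in> sets S \<Longrightarrow> AE t in N. emeasure (F t) A = emeasure (F' t) A"
    and F: "AE t in N. sets (F t) = sets S"
    and F': "AE t in N. sets (F' t) = sets S" "AE t in N. finite_measure (F' t)"
  shows "AE t in N. F t = F' t"
proof -
  obtain G where G: "countable G" "Int_stable G" "space S \<in> G" "G \<subseteq> Pow (space S)"
    "sets S = sigma_sets (space S) G"
    by (rule standard_borel_space_countable_generator[OF S])
  have "AE t in N. \<forall>A\<in>G. emeasure (F t) A = emeasure (F' t) A"
    using G(1,5) eq by (subst AE_ball_countable) auto
  then show ?thesis
    using F F'
  proof eventually_elim
    case (elim t)
    show ?case
    proof (rule measure_eqI_generator_eq[OF G(2,4), where A="\<lambda>_. space S"])
      have "emeasure (F' t) (space S) \<noteq> \<infinity>"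
        using elim(4) by (simp add: finite_measure.emeasure_finite)
      then show "emeasure (F t) (space S) \<noteq> \<infinity>" for i :: nat
        using elim(1) G(3) by simp
    qed (use elim G in auto)
  qed
qed

section \<open>Conditional laws on rectangles and under independence\<close>

lemma conditional_law_emeasure_Times:
  assumes "conditional_law M SX X SY Y K"
    and [measurable]: "X \<in> M \<rightarrow>\<^sub>M SX" "Y \<in> M \<rightarrow>\<^sub>M SY" "A \<in> sets SX" "B \<in> sets SY"
  shows "emeasure M {\<omega> \<in> space M. X \<omega> \<in> A \<and> Y \<omega> \<in> B} =
    (\<integral>\<^sup>+ y. emeasure (K y) A * indicator B y \<partial>distr M SY Y)"
proof -
  have K: "K \<in> SY \<rightarrow>\<^sub>M prob_algebra SX"
    using assms(1) by (simp add: conditional_law_def)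
  have "emeasure M {\<omega> \<in> space M. X \<omega> \<in> A \<and> Y \<omega> \<in> B} =
      emeasure (distr M (SX \<Otimes>\<^sub>M SY) (\<lambda>\<omega>. (X \<omega>, Y \<omega>))) (A \<times> B)"
    by (subst emeasure_distr) (auto intro!: arg_cong[where f="emeasure M"])
  also have "\<dots> = (\<integral>\<^sup>+ y. (\<integral>\<^sup>+ x. indicator (A \<times> B) (x, y) \<partial>K y) \<partial>distr M SY Y)"
    using assms(1) unfolding conditional_law_def by simp
  also have "\<dots> = (\<integral>\<^sup>+ y. emeasure (K y) A * indicator B y \<partial>distr M SY Y)"
  proof (rule nn_integral_cong)
    fix y assume "y \<in> space (distr M SY Y)"
    then have "sets (K y) = sets SX"
      using measurable_space[OF K] by (simp add: space_prob_algebra)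
    then have "(\<integral>\<^sup>+ x. indicator A x * indicator B y \<partial>K y) = emeasure (K y) A * indicator B y"
      by (subst nn_integral_multc) auto
    then show "(\<integral>\<^sup>+ x. indicator (A \<times> B) (x, y) \<partial>K y) = emeasure (K y) A * indicator B y"
      by (simp add: indicator_times)
  qed
  finally show ?thesis .
qed

text \<open>A constant conditional law makes the joint law the product of \<open>N\<close> and the
  law of \<open>Y\<close>. By Fubini, \<open>X\<close> can be frozen at a value \<open>x\<close>
  while only \<open>Y\<close> remains random. This is how \<open>\<tau> (U, \<Theta>)\<close> is
  reduced to \<open>\<tau> (u, \<Theta>)\<close> for fixed \<open>u\<close>.\<close>

lemma independent_iterated_integral:
  assumes "conditional_law M SX X SY Y (\<lambda>_. N)"
    and [measurable]: "X \<in> M \<rightarrow>\<^sub>M SX" "Y \<in> M \<rightarrow>\<^sub>M SY"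
    and "sigma_finite_measure (distr M SY Y)" "space SY \<noteq> {}"
    and C[measurable]: "Measurable.pred (SX \<Otimes>\<^sub>M SY) (\<lambda>(x, y). C x y)"
  shows "emeasure M {\<omega> \<in> space M. C (X \<omega>) (Y \<omega>)} =
    (\<integral>\<^sup>+ x. emeasure M {\<omega> \<in> space M. C x (Y \<omega>)} \<partial>N)"
proof -
  let ?C = "{p \<in> space (SX \<Otimes>\<^sub>M SY). C (fst p) (snd p)}"
  \<comment> \<open>Measurability of the constant kernel says something about \<open>N\<close> only
    if there is a point of \<open>SY\<close> at which to evaluate it.\<close>
  have N: "N \<in> space (prob_algebra SX)"
    using assms(1,5) by (auto simp: conditional_law_def dest: measurable_space)
  then have N_sets[measurable_cong]: "sets N = sets SX" and "prob_space N"
    by (auto simp: space_prob_algebra)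
  then interpret N: prob_space N by simp
  interpret Y: sigma_finite_measure "distr M SY Y" by fact
  interpret NY: pair_sigma_finite N "distr M SY Y" ..
  have N_space: "space N = space SX" by (rule sets_eq_imp_space_eq) (rule N_sets)
  have C_sets[measurable]: "?C \<in> sets (SX \<Otimes>\<^sub>M SY)" by measurable
  have "emeasure M {\<omega> \<in> space M. C (X \<omega>) (Y \<omega>)} =
      emeasure (distr M (SX \<Otimes>\<^sub>M SY) (\<lambda>\<omega>. (X \<omega>, Y \<omega>))) ?C"
    by (subst emeasure_distr)
       (auto intro!: arg_cong[where f="emeasure M"] simp: space_pair_measure
         dest: measurable_space[OF assms(2)] measurable_space[OF assms(3)])
  also have "\<dots> = (\<integral>\<^sup>+ y. (\<integral>\<^sup>+ x. indicator ?C (x, y) \<partial>N) \<partial>distr M SY Y)"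
    using assms(1) C_sets unfolding conditional_law_def by blast
  also have "\<dots> = (\<integral>\<^sup>+ x. (\<integral>\<^sup>+ y. indicator ?C (x, y) \<partial>distr M SY Y) \<partial>N)"
    by (rule NY.Fubini) measurable
  also have "\<dots> = (\<integral>\<^sup>+ x. emeasure M {\<omega> \<in> space M. C x (Y \<omega>)} \<partial>N)"
  proof (rule nn_integral_cong)
    fix x assume "x \<in> space N"
    then have x: "x \<in> space SX" by (simp add: N_space)
    then have "(\<integral>\<^sup>+ y. indicator ?C (x, y) \<partial>distr M SY Y) =
        (\<integral>\<^sup>+ \<omega>. indicator ?C (x, Y \<omega>) \<partial>M)"
      by (intro nn_integral_distr) measurable
    also have "\<dots> = (\<integral>\<^sup>+ \<omega>. indicator {\<omega> \<in> space M. C x (Y \<omega>)} \<omega> \<partial>M)"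
      using x by (intro nn_integral_cong)
        (auto simp: indicator_def space_pair_measure dest: measurable_space[OF assms(3)])
    also have "\<dots> = emeasure M {\<omega> \<in> space M. C x (Y \<omega>)}"
      using x by (intro nn_integral_indicator) measurable
    finally show "(\<integral>\<^sup>+ y. indicator ?C (x, y) \<partial>distr M SY Y) =
        emeasure M {\<omega> \<in> space M. C x (Y \<omega>)}" .
  qed
  finally show ?thesis .
qed

section \<open>Normalized weighted laws and mixtures over them\<close>

lemma proportional_law_prob_space:
  assumes [measurable]: "f \<in> borel_measurable N"
    and "(\<integral>\<^sup>+ u. ennreal (f u) \<partial>N) \<noteq> 0" "(\<integral>\<^sup>+ u. ennreal (f u) \<partial>N) \<noteq> \<infinity>"
  shows "prob_space (proportional_law N f)"
proof (rule prob_spaceI)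
  have "emeasure (proportional_law N f) (space (proportional_law N f)) =
      (\<integral>\<^sup>+ u. ennreal (f u) / (\<integral>\<^sup>+ u'. ennreal (f u') \<partial>N) \<partial>N)"
    unfolding proportional_law_def
    by (subst emeasure_density) (auto intro!: nn_integral_cong simp: indicator_def)
  also have "\<dots> = 1"
    using assms by (simp add: nn_integral_divide less_top)
  finally show "emeasure (proportional_law N f) (space (proportional_law N f)) = 1" .
qed

text \<open>Division in \<open>ennreal\<close> is multiplication by the inverse, so the normalizer
  leaves the integral as a constant factor even when it is \<open>0\<close> or
  \<open>\<infinity>\<close>. The assumption \<open>ne\<close> excludes the default value that
  \<open>bind\<close> has over an empty space.\<close>

lemma emeasure_bind_proportional_law:
  assumes [measurable]: "f \<in> borel_measurable N"
    and K: "K \<in> N \<rightarrow>\<^sub>M prob_algebra S" and [measurable]: "A \<in> sets S" and ne: "space N \<noteq> {}"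
  shows "emeasure (proportional_law N f \<bind> K) A =
    (\<integral>\<^sup>+ u. ennreal (f u) * emeasure (K u) A \<partial>N) / (\<integral>\<^sup>+ u. ennreal (f u) \<partial>N)"
proof -
  have K'[measurable]: "K \<in> N \<rightarrow>\<^sub>M subprob_algebra S"
    using K by (rule measurable_prob_algebraD)
  have [measurable]: "(\<lambda>u. emeasure (K u) A) \<in> borel_measurable N"
    by (rule measurable_emeasure_kernel[OF K']) fact
  have "emeasure (proportional_law N f \<bind> K) A =
      (\<integral>\<^sup>+ u. emeasure (K u) A \<partial>proportional_law N f)"
    using ne by (intro emeasure_bind[where N=S]) (simp_all add: proportional_law_def)
  also have "\<dots> = (\<integral>\<^sup>+ u. ennreal (f u) / (\<integral>\<^sup>+ u'. ennreal (f u') \<partial>N) * emeasure (K u) A \<partial>N)"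
    unfolding proportional_law_def by (rule nn_integral_density) measurable
  also have "\<dots> = (\<integral>\<^sup>+ u. ennreal (f u) * emeasure (K u) A / (\<integral>\<^sup>+ u'. ennreal (f u') \<partial>N) \<partial>N)"
    by (simp add: divide_ennreal_def ac_simps)
  also have "\<dots> = (\<integral>\<^sup>+ u. ennreal (f u) * emeasure (K u) A \<partial>N) / (\<integral>\<^sup>+ u. ennreal (f u) \<partial>N)"
    by (rule nn_integral_divide) measurable
  finally show ?thesis .
qed

theorem theorem2:
  fixes M :: "'w measure"
    and SU :: "'u measure" and S\<Theta> :: "'p measure" and ST :: "'t measure"
    and U :: "'w \<Rightarrow> 'u" and \<Theta> :: "'w \<Rightarrow> 'p" and T :: "'w \<Rightarrow> 't"
    and \<tau> :: "'u \<times> 'p \<Rightarrow> 't"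
    and PU :: "'p \<Rightarrow> 'u measure"
    and \<mu> :: "'t measure" and w :: "'t \<Rightarrow> 'u \<Rightarrow> real"
    and K :: "'u \<times> 't \<Rightarrow> 'p measure" and Post :: "'t \<Rightarrow> 'p measure"
  assumes "sigma_finite_measure M"
    and "standard_borel_space SU" and "standard_borel_space S\<Theta>" and "standard_borel_space ST"
    and "sigma_finite_element M S\<Theta> \<Theta>"
    and "conventional_fiducial_model M SU S\<Theta> ST U \<tau> \<Theta> PU"
    and "T = (\<lambda>\<omega>. \<tau> (U \<omega>, \<Theta> \<omega>))"
    and "sigma_finite_element M ST T"
    and "sets \<mu> = sets ST" and "sigma_finite_measure \<mu>"
    and "(\<lambda>(t, u). w t u) \<in> borel_measurable (ST \<Otimes>\<^sub>M SU)"
    and "\<And>t u. t \<in> space ST \<Longrightarrow> u \<in> space SU \<Longrightarrow> 0 \<le> w t u"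
    and "\<And>u. u \<in> space SU \<Longrightarrow>
           distr M ST (\<lambda>\<omega>. \<tau> (u, \<Theta> \<omega>)) = density \<mu> (\<lambda>t. ennreal (w t u))"
    and "K \<in> SU \<Otimes>\<^sub>M ST \<rightarrow>\<^sub>M prob_algebra S\<Theta>"
    and "\<And>u. u \<in> space SU \<Longrightarrow>
           conditional_law M S\<Theta> \<Theta> ST (\<lambda>\<omega>. \<tau> (u, \<Theta> \<omega>)) (\<lambda>t. K (u, t))"
    and "conditional_law M S\<Theta> \<Theta> ST T Post"
  shows "AE t in distr M ST T. \<forall>\<theta>\<^sub>0 \<in> space S\<Theta>.
           prob_space (proportional_law (PU \<theta>\<^sub>0) (w t)) \<and>
           (proportional_law (PU \<theta>\<^sub>0) (w t) \<bind> (\<lambda>u. K (u, t))) = Post t"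
proof (cases "space S\<Theta> = {}")
  case True
  then show ?thesis by simp
next
  case False
  then obtain \<theta> where \<theta>: "\<theta> \<in> space S\<Theta>" by blast
  \<comment> \<open>\<open>N\<close> is the common value of the conditional laws of
    \<open>U\<close>, read off at an arbitrary parameter. If there is no parameter, the claim is
    vacuous.\<close>
  define N where "N = PU \<theta>"
  have PU_eq: "PU \<theta>' = N" if "\<theta>' \<in> space S\<Theta>" for \<theta>'
    using assms(6) \<theta> that unfolding conventional_fiducial_model_def N_def by blast
  have [measurable]: "U \<in> M \<rightarrow>\<^sub>M SU" "\<tau> \<in> SU \<Otimes>\<^sub>M S\<Theta> \<rightarrow>\<^sub>M ST" "\<Theta> \<in> M \<rightarrow>\<^sub>M S\<Theta>" "T \<in> M \<rightarrow>\<^sub>M ST"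
    and PU: "conditional_law M SU U S\<Theta> \<Theta> PU"
    and sigma_\<Theta>: "sigma_finite_measure (distr M S\<Theta> \<Theta>)"
    using assms(5,6,8)
    by (auto simp: conventional_fiducial_model_def fiducial_model_def sigma_finite_element_def)
  note [measurable] = assms(11)
  have [measurable_cong]: "sets \<mu> = sets ST" by fact
  have sp_\<mu>: "space \<mu> = space ST" by (rule sets_eq_imp_space_eq) fact
  interpret \<mu>: sigma_finite_measure \<mu> by fact
  interpret T: sigma_finite_measure "distr M ST T"
    using assms(8) by (simp add: sigma_finite_element_def)

  \<comment> \<open>The parameter-free law of \<open>U\<close>\<close>
  \<comment> \<open>\<open>PU\<close> is constant only on \<open>space S\<Theta>\<close>, which is
    all that the integral against the law of \<open>\<Theta>\<close> sees.\<close>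
  have U_N: "conditional_law M SU U S\<Theta> \<Theta> (\<lambda>_. N)"
  proof -
    have "N \<in> space (prob_algebra SU)"
      using PU \<theta> unfolding conditional_law_def N_def by (auto dest: measurable_space)
    moreover have "(\<integral>\<^sup>+ y. (\<integral>\<^sup>+ x. indicator C (x, y) \<partial>PU y) \<partial>distr M S\<Theta> \<Theta>) =
        (\<integral>\<^sup>+ y. (\<integral>\<^sup>+ x. indicator C (x, y) \<partial>N) \<partial>distr M S\<Theta> \<Theta>)" for C
      by (intro nn_integral_cong) (simp add: PU_eq)
    ultimately show ?thesis
      using PU unfolding conditional_law_def by simp
  qed
  then have N: "N \<in> space (prob_algebra SU)"
    using \<theta> by (auto simp: conditional_law_def dest: measurable_space)
  then have N_sets[measurable_cong]: "sets N = sets SU" and "prob_space N"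
    by (auto simp: space_prob_algebra)
  then interpret N: prob_space N by simp
  interpret N\<mu>: pair_sigma_finite N \<mu> ..
  have sp_N: "space N = space SU" by (rule sets_eq_imp_space_eq) (rule N_sets)

  have K_meas[measurable]: "(\<lambda>(t, u). emeasure (K (u, t)) A) \<in> borel_measurable (ST \<Otimes>\<^sub>M SU)"
    if "A \<in> sets S\<Theta>" for A
  proof -
    have "K \<in> SU \<Otimes>\<^sub>M ST \<rightarrow>\<^sub>M subprob_algebra S\<Theta>"
      using assms(14) by (rule measurable_prob_algebraD)
    from measurable_emeasure_kernel[OF this that]
    have [measurable]: "(\<lambda>p. emeasure (K p) A) \<in> borel_measurable (SU \<Otimes>\<^sub>M ST)" .
    show ?thesis by measurable
  qed
  have K_prob: "prob_space (K (u, t))" "sets (K (u, t)) = sets S\<Theta>"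
    if "u \<in> space SU" "t \<in> space ST" for u t
    using measurable_space[OF assms(14), of "(u, t)"] that
    by (auto simp: space_prob_algebra space_pair_measure)

  \<comment> \<open>The joint law of \<open>\<Theta>\<close> and \<open>T\<close>, relative to
    \<open>\<mu>\<close>\<close>
  \<comment> \<open>\<open>W\<close> is the normalizing integral of the first sampling stage.
    \<open>H A\<close> is the unnormalized mass of \<open>A\<close> after both stages, so
    \<open>H A t / W t\<close> is the probability with which the sampled parameter falls in
    \<open>A\<close>.\<close>
  define W where "W t = (\<integral>\<^sup>+ u. ennreal (w t u) \<partial>N)" for t
  define H where "H A t = (\<integral>\<^sup>+ u. ennreal (w t u) * emeasure (K (u, t)) A \<partial>N)" for A t
  have W_meas[measurable]: "W \<in> borel_measurable ST"
    unfolding W_def by measurable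
  have H_meas[measurable]: "H A \<in> borel_measurable ST" if [measurable]: "A \<in> sets S\<Theta>" for A
    unfolding H_def by measurable

  \<comment> \<open>Independence fixes \<open>u\<close>, the kernel \<open>K\<close> disintegrates
    \<open>\<Theta>\<close> over \<open>\<tau> (u, \<Theta>)\<close>, and the density
    \<open>w\<close> replaces that law by \<open>\<mu>\<close>. Since \<open>\<mu>\<close> does not
    depend on \<open>u\<close>, Fubini can then move the integral over \<open>u\<close>
    inside.\<close>
  have joint: "emeasure M {\<omega> \<in> space M. \<Theta> \<omega> \<in> A \<and> T \<omega> \<in> B} = (\<integral>\<^sup>+ t. H A t * indicator B t \<partial>\<mu>)"
    if [measurable]: "A \<in> sets S\<Theta>" "B \<in> sets ST" for A B
  proof -
    have "emeasure M {\<omega> \<in> space M. \<Theta> \<omega> \<in> A \<and> T \<omega> \<in> B} =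
        (\<integral>\<^sup>+ u. emeasure M {\<omega> \<in> space M. \<Theta> \<omega> \<in> A \<and> \<tau> (u, \<Theta> \<omega>) \<in> B} \<partial>N)"
      unfolding assms(7)
      by (rule independent_iterated_integral[OF U_N _ _ sigma_\<Theta> False]) measurable
    also have "\<dots> = (\<integral>\<^sup>+ u. (\<integral>\<^sup>+ t. ennreal (w t u) * (emeasure (K (u, t)) A * indicator B t) \<partial>\<mu>) \<partial>N)"
    proof (rule nn_integral_cong)
      fix u assume "u \<in> space N"
      then have u[measurable]: "u \<in> space SU" by (simp add: sp_N)
      have "emeasure M {\<omega> \<in> space M. \<Theta> \<omega> \<in> A \<and> \<tau> (u, \<Theta> \<omega>) \<in> B} =
          (\<integral>\<^sup>+ t. emeasure (K (u, t)) A * indicator B t \<partial>distr M ST (\<lambda>\<omega>. \<tau> (u, \<Theta> \<omega>)))"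
        by (rule conditional_law_emeasure_Times[OF assms(15)[OF u]]) measurable
      also have "\<dots> = (\<integral>\<^sup>+ t. ennreal (w t u) * (emeasure (K (u, t)) A * indicator B t) \<partial>\<mu>)"
        unfolding assms(13)[OF u] by (rule nn_integral_density) measurable
      finally show "emeasure M {\<omega> \<in> space M. \<Theta> \<omega> \<in> A \<and> \<tau> (u, \<Theta> \<omega>) \<in> B} = \<dots>" .
    qed
    also have "\<dots> = (\<integral>\<^sup>+ t. (\<integral>\<^sup>+ u. ennreal (w t u) * (emeasure (K (u, t)) A * indicator B t) \<partial>N) \<partial>\<mu>)"
      by (rule N\<mu>.Fubini'[symmetric]) measurable
    also have "\<dots> = (\<integral>\<^sup>+ t. H A t * indicator B t \<partial>\<mu>)"
      unfolding H_def mult.assoc[symmetric]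
      by (intro nn_integral_cong nn_integral_multc) (simp add: sp_\<mu>)
    finally show ?thesis .
  qed

  have H_space: "H (space S\<Theta>) t = W t" if t: "t \<in> space ST" for t
    unfolding H_def W_def
  proof (rule nn_integral_cong)
    fix u assume "u \<in> space N"
    then have "u \<in> space SU" by (simp add: sp_N)
    note K = K_prob[OF this t]
    have "emeasure (K (u, t)) (space S\<Theta>) = 1"
      using prob_space.emeasure_space_1[OF K(1)] sets_eq_imp_space_eq[OF K(2)] by simp
    then show "ennreal (w t u) * emeasure (K (u, t)) (space S\<Theta>) = ennreal (w t u)" by simp
  qed
  \<comment> \<open>This forces \<open>H A t = 0\<close> wherever \<open>W t = 0\<close>, the case
    in which dividing by \<open>W t\<close> loses information.\<close>
  have H_le: "H A t \<le> W t" if t: "t \<in> space ST" for A t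
    unfolding H_def W_def
  proof (rule nn_integral_mono)
    fix u assume "u \<in> space N"
    then have "emeasure (K (u, t)) A \<le> 1"
      using K_prob(1)[OF _ t] by (simp add: sp_N prob_space.emeasure_le_1)
    then show "ennreal (w t u) * emeasure (K (u, t)) A \<le> ennreal (w t u)"
      using mult_left_mono[of _ 1 "ennreal (w t u)"] by simp
  qed

  \<comment> \<open>The density of \<open>T\<close> and its range\<close>
  have law_T: "distr M ST T = density \<mu> W"
  proof (rule measure_eqI)
    fix B assume "B \<in> sets (distr M ST T)"
    then have B[measurable]: "B \<in> sets ST" by simp
    have "emeasure (distr M ST T) B = emeasure M {\<omega> \<in> space M. \<Theta> \<omega> \<in> space S\<Theta> \<and> T \<omega> \<in> B}"
      by (subst emeasure_distr)
         (auto intro!: arg_cong[where f="emeasure M"] dest: measurable_space[OF \<open>\<Theta> \<in> M \<rightarrow>\<^sub>M S\<Theta>\<close>])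
    also have "\<dots> = (\<integral>\<^sup>+ t. W t * indicator B t \<partial>\<mu>)"
      by (subst joint) (auto intro!: nn_integral_cong simp: H_space sp_\<mu>)
    also have "\<dots> = emeasure (density \<mu> W) B"
      by (rule emeasure_density[symmetric]) measurable
    finally show "emeasure (distr M ST T) B = emeasure (density \<mu> W) B" .
  qed (simp add: assms(9))

  \<comment> \<open>The zero set of a density is null for the measure with that density.\<close>
  have W_pos: "AE t in distr M ST T. W t \<noteq> 0"
    unfolding law_T by (subst AE_density) auto
  \<comment> \<open>Sigma-finiteness of \<open>T\<close> enters here: over the sigma-finite
    \<open>\<mu>\<close>, a density defines a sigma-finite measure exactly when it is finite almost
    everywhere. The statement for \<open>\<mu>\<close> serves the cancellation under the integral
    below, the one for the law of \<open>T\<close> the normalization.\<close>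
  have W_fin_\<mu>: "AE t in \<mu>. W t \<noteq> \<infinity>"
    using T.sigma_finite_measure_axioms unfolding law_T
    by (subst (asm) \<mu>.sigma_finite_iff_density_finite) auto
  then have W_fin: "AE t in distr M ST T. W t \<noteq> \<infinity>"
    unfolding law_T by (subst AE_density) auto

  \<comment> \<open>Identification with the posterior, first for each event and then as
    measures\<close>
  have Post: "Post \<in> ST \<rightarrow>\<^sub>M prob_algebra S\<Theta>"
    using assms(16) by (simp add: conditional_law_def)
  \<comment> \<open>For fixed \<open>A\<close>, both sides are densities of
    \<open>B \<mapsto> P(\<Theta> \<in> A, T \<in> B)\<close> with respect to the law of
    \<open>T\<close>. That law is sigma-finite, so densities are unique almost everywhere.\<close>
  have Post_eq: "AE t in distr M ST T. H A t / W t = emeasure (Post t) A"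
    if A[measurable]: "A \<in> sets S\<Theta>" for A
  proof -
    have [measurable]: "(\<lambda>t. emeasure (Post t) A) \<in> borel_measurable ST"
      by (rule measurable_emeasure_kernel[OF measurable_prob_algebraD[OF Post] A])
    have "density (distr M ST T) (\<lambda>t. H A t / W t) =
        density (distr M ST T) (\<lambda>t. emeasure (Post t) A)"
    proof (rule measure_eqI)
      fix B assume "B \<in> sets (density (distr M ST T) (\<lambda>t. H A t / W t))"
      then have B[measurable]: "B \<in> sets ST" by simp
      have "emeasure (density (distr M ST T) (\<lambda>t. H A t / W t)) B =
          (\<integral>\<^sup>+ t. W t * (H A t / W t * indicator B t) \<partial>\<mu>)"
        by (subst emeasure_density, measurable)
           (simp add: law_T nn_integral_density del: ennreal_indicator)
      also have "\<dots> = (\<integral>\<^sup>+ t. H A t * indicator B t \<partial>\<mu>)"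
      proof (rule nn_integral_cong_AE)
        \<comment> \<open>Cancelling \<open>W t\<close> in \<open>ennreal\<close> requires it to be
          neither \<open>0\<close> nor \<open>\<infinity>\<close>. Infinite values are
          \<open>\<mu>\<close>-null, and at a zero both sides vanish by \<open>H_le\<close>.\<close>
        show "AE t in \<mu>. W t * (H A t / W t * indicator B t) = H A t * indicator B t"
          using W_fin_\<mu>
        proof (rule AE_mp, intro AE_I2 impI)
          fix t assume t: "t \<in> space \<mu>" "W t \<noteq> \<infinity>"
          show "W t * (H A t / W t * indicator B t) = H A t * indicator B t"
          proof (cases "W t = 0")
            case True
            then show ?thesis using H_le[of t A] t by (simp add: sp_\<mu>)
          next
            case False
            then have "W t * (H A t / W t) = H A t"
              using t ennreal_mult_divide_eq[of "W t" "H A t"]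
              by (simp add: ennreal_times_divide mult.commute[of "W t"])
            then show ?thesis by (simp add: mult.assoc[symmetric])
          qed
        qed
      qed
      also have "\<dots> = emeasure M {\<omega> \<in> space M. \<Theta> \<omega> \<in> A \<and> T \<omega> \<in> B}"
        by (rule joint[symmetric]) fact+
      also have "\<dots> = (\<integral>\<^sup>+ t. emeasure (Post t) A * indicator B t \<partial>distr M ST T)"
        by (rule conditional_law_emeasure_Times[OF assms(16)]) measurable
      also have "\<dots> = emeasure (density (distr M ST T) (\<lambda>t. emeasure (Post t) A)) B"
        by (rule emeasure_density[symmetric]) measurable
      finally show "emeasure (density (distr M ST T) (\<lambda>t. H A t / W t)) B = \<dots>" .
    qed simp
    then show ?thesis
      by (subst (asm) T.density_unique_iff) auto
  qed

  have w_meas: "w t \<in> borel_measurable N" if [measurable]: "t \<in> space ST" for t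
    by measurable
  have K_kernel: "(\<lambda>u. K (u, t)) \<in> N \<rightarrow>\<^sub>M prob_algebra S\<Theta>" if [measurable]: "t \<in> space ST" for t
  proof -
    note [measurable] = assms(14)
    show ?thesis by measurable
  qed
  have space_T: "AE t in distr M ST T. t \<in> space ST"
    by (rule AE_I2) simp
  have "AE t in distr M ST T. proportional_law N (w t) \<bind> (\<lambda>u. K (u, t)) = Post t"
  \<comment> \<open>The two-stage law gives \<open>A\<close> the mass \<open>H A t / W t\<close>, so
    \<open>Post_eq\<close> settles each event. The finiteness that the rule asks of its second
    family comes from \<open>Post t\<close> being a probability measure.\<close>
  proof (rule AE_eq_measure_if_standard_borel[OF assms(3)])
    fix A assume A: "A \<in> sets S\<Theta>"
    show "AE t in distr M ST T.
        emeasure (proportional_law N (w t) \<bind> (\<lambda>u. K (u, t))) A = emeasure (Post t) A"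
      using Post_eq[OF A] space_T
    proof eventually_elim
      case (elim t)
      then show ?case
        by (simp add: emeasure_bind_proportional_law[OF w_meas K_kernel A N.not_empty] H_def W_def)
    qed
  next
    show "AE t in distr M ST T. sets (proportional_law N (w t) \<bind> (\<lambda>u. K (u, t))) = sets S\<Theta>"
      using K_prob N.not_empty
      by (intro AE_I2 sets_bind) (auto simp: proportional_law_def sp_N)
  qed (use measurable_space[OF Post] in
        \<open>auto intro!: AE_I2 simp: space_prob_algebra prob_space_def\<close>)
  moreover have "AE t in distr M ST T. prob_space (proportional_law N (w t))"
    using W_pos W_fin space_T
    by eventually_elim (simp add: proportional_law_prob_space w_meas W_def)
  ultimately show ?thesis
    \<comment> \<open>The null set found for \<open>N\<close> serves every
      \<open>\<theta>\<^sub>0\<close> at once, since \<open>PU \<theta>\<^sub>0\<close> is always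
      \<open>N\<close>.\<close>
    by eventually_elim (simp add: PU_eq)
qed

end
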